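(* Let $m\ge 3$ be odd. For the coloring $(f_0,f_1,f_2)$ of $D_3(m)$ defined below, each $f_c$ is a single directed cycle through all $m^3$ vertices; thus the three color classes decompose the arc set of $D_3(m)$ into three directed Hamilton cycles.
   Context: $V=(\mathbb Z_m)^3$ with points $v=(i,j,k)$; $D_3(m)$ has arcs $v\to v+e_1,v+e_2,v+e_3$ (mod $m$), $e_1,e_2,e_3$ the standard basis vectors; $S(v)=i+j+k\pmod m$; $\mathrm{bump}_i(i,j,k)=(i+1,j,k)$, $\mathrm{bump}_j(i,j,k)=(i,j+1,k)$, $\mathrm{bump}_k(i,j,k)=(i,j,k+1)$. The coloring is: $f_0(v)=\mathrm{bump}_j(v)$ if $S=0,k\ne0$; $\mathrm{bump}_k(v)$ if $S=1$; $\mathrm{bump}_i(v)$ otherwise. $f_1(v)=\mathrm{bump}_k(v)$ if $S=0$; $\mathrm{bump}_i(v)$ if $S=1,k=0$; $\mathrm{bump}_j(v)$ otherwise. $f_2(v)=\mathrm{bump}_j(v)$ if $S\in\{0,1\},k=0$; $\mathrm{bump}_i(v)$ if $S\in\{0,1\},k\ne0$; $\mathrm{bump}_k(v)$ otherwise. (It is a coloring: each $f_c$ is a permutation of $V$ and $\{f_0(v),f_1(v),f_2(v)\}=\{v+e_1,v+e_2,v+e_3\}$.) *)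

theory Defs
  imports "HOL-Combinatorics.Orbits" "Graph_Theory.Graph_Theory"
begin

text \<open>Elements of \<open>\<int>\<^sub>m\<close> are represented by their least residues \<open>0, \<dots>, m - 1\<close>.\<close>

type_synonym vertex = "nat \<times> nat \<times> nat"

definition V :: "nat \<Rightarrow> vertex set" where
  "V m = {0..<m} \<times> {0..<m} \<times> {0..<m}"

fun bump_i :: "nat \<Rightarrow> vertex \<Rightarrow> vertex" where
  "bump_i m (i, j, k) = ((i + 1) mod m, j, k)"

fun bump_j :: "nat \<Rightarrow> vertex \<Rightarrow> vertex" where
  "bump_j m (i, j, k) = (i, (j + 1) mod m, k)"

fun bump_k :: "nat \<Rightarrow> vertex \<Rightarrow> vertex" where
  "bump_k m (i, j, k) = (i, j, (k + 1) mod m)"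

text \<open>The arcs \<open>v \<rightarrow> v + e\<^sub>1\<close>, \<open>v \<rightarrow> v + e\<^sub>2\<close>, \<open>v \<rightarrow> v + e\<^sub>3\<close> are represented as pairs of
  vertices, which loses no multiplicities when \<open>m \<ge> 2\<close>.\<close>

definition D3 :: "nat \<Rightarrow> vertex pair_pre_digraph" where
  "D3 m = \<lparr> pverts = V m,
            parcs = {(v, w). v \<in> V m \<and> w \<in> {bump_i m v, bump_j m v, bump_k m v}} \<rparr>"

fun S :: "nat \<Rightarrow> vertex \<Rightarrow> nat" where
  "S m (i, j, k) = (i + j + k) mod m"

fun third :: "vertex \<Rightarrow> nat" where
  "third (i, j, k) = k"

definition f0 :: "nat \<Rightarrow> vertex \<Rightarrow> vertex" where
  "f0 m v =
    (if S m v = 0 \<and> third v \<noteq> 0 then bump_j m v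
     else if S m v = 1 then bump_k m v
     else bump_i m v)"

definition f1 :: "nat \<Rightarrow> vertex \<Rightarrow> vertex" where
  "f1 m v =
    (if S m v = 0 then bump_k m v
     else if S m v = 1 \<and> third v = 0 then bump_i m v
     else bump_j m v)"

definition f2 :: "nat \<Rightarrow> vertex \<Rightarrow> vertex" where
  "f2 m v =
    (if S m v \<in> {0, 1} \<and> third v = 0 then bump_j m v
     else if S m v \<in> {0, 1} \<and> third v \<noteq> 0 then bump_i m v
     else bump_k m v)"

definition coloring :: "nat \<Rightarrow> nat \<Rightarrow> vertex \<Rightarrow> vertex" where
  "coloring m c = (if c = 0 then f0 m else if c = 1 then f1 m else f2 m)"

definition color_class :: "nat \<Rightarrow> nat \<Rightarrow> (vertex \<times> vertex) set" where
  "color_class m c = {(v, coloring m c v) | v. v \<in> V m}"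

text \<open>An arc set is a directed Hamilton cycle if it consists of the arcs of a directed cycle
  visiting every vertex; the vertices of a cycle are the tails of its arcs.\<close>

definition hamilton_cycle :: "('a, 'b) pre_digraph \<Rightarrow> 'b set \<Rightarrow> bool" where
  "hamilton_cycle G A \<longleftrightarrow>
    (\<exists>p. pre_digraph.cycle G p \<and> set p = A \<and> tail G ` set p = verts G)"

definition hamilton_decomposition ::
    "('a, 'b) pre_digraph \<Rightarrow> 'c set \<Rightarrow> ('c \<Rightarrow> 'b set) \<Rightarrow> bool" where
  "hamilton_decomposition G C A \<longleftrightarrow>
    (\<Union>c\<in>C. A c) = arcs G \<and> disjoint_family_on A C \<and> (\<forall>c\<in>C. hamilton_cycle G (A c))"

end

(* Measuring a vertex by its first coordinate i, its third coordinate k and its layer S, every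
   colour acts as a skew product: the layer always grows by 1, k changes by an amount depending
   only on the layer, and i by an amount depending only on k and the layer.  Hence the colour is a
   permutation, and its m-th power maps the layer S = 0 to itself.  That return map adds a constant
   b to k, and adds to i a constant \<beta>, except on one column k = c, where it adds \<alpha>.
   Going once around the columns therefore adds \<alpha> - \<beta> to i, so all vertices lie on one
   cycle as soon as b and \<alpha> - \<beta> are units mod m.  The triples (b, \<alpha>, \<beta>) are
   (1, -1, -2), (1, 1, 0) and (-2, 0, 2); only the last one needs m odd. *)

theory Submission
  imports Defs
begin

section \<open>Cyclic maps and Hamilton cycles\<close>

text \<open>An injective map permutes every finite invariant set, hence \<open>orbit f s\<close>.
  Membership in that orbit therefore pulls back from \<open>f v\<close> to \<open>v\<close>, so
  every path ending in \<open>s\<close> lies in it.\<close>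

lemma cyclic_onI_reaches:
  assumes "finite A" "inj_on f A" "f ` A \<subseteq> A" "s \<in> A"
    and reach: "\<And>v. v \<in> A \<Longrightarrow> \<exists>n. (f ^^ n) v = s"
  shows "cyclic_on f A"
proof (rule cyclic_on_singleI[OF \<open>s \<in> A\<close>], rule antisym)
  show sub: "orbit f s \<subseteq> A"
  proof
    fix x assume "x \<in> orbit f s"
    then show "x \<in> A" by induct (use assms in auto)
  qed
  have img: "f ` orbit f s = orbit f s"
  proof (rule endo_inj_surj)
    show "finite (orbit f s)" using sub \<open>finite A\<close> by (rule finite_subset)
    show "f ` orbit f s \<subseteq> orbit f s" by (auto intro: orbit.step)
    show "inj_on f (orbit f s)" using \<open>inj_on f A\<close> sub by (rule inj_on_subset)
  qed
  \<comment> \<open>\<open>orbit f s\<close> starts at \<open>f s\<close>, so \<open>s\<close>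
    belongs to it only by a return in a positive number of steps; starting from \<open>f s\<close>
    supplies the extra step.\<close>
  obtain n where "(f ^^ n) (f s) = s" using reach[of "f s"] assms by blast
  then have "(f ^^ Suc n) s = s" by (simp only: funpow_Suc_right comp_apply)
  then have self: "s \<in> orbit f s"
    unfolding orbit_altdef by (metis (mono_tags, lifting) mem_Collect_eq zero_less_Suc)
  have "v \<in> orbit f s" if "v \<in> A" "(f ^^ n) v = s" for n v
    using that
  proof (induction n arbitrary: v)
    case 0
    then show ?case using self by simp
  next
    case (Suc n)
    have "(f ^^ n) (f v) = s" using Suc.prems(2) by (simp only: funpow_Suc_right comp_apply)
    moreover have "f v \<in> A" using Suc.prems(1) assms(3) by blast
    ultimately have "f v \<in> f ` orbit f s" using Suc.IH img by simp
    then show ?case using Suc.prems(1) assms(2) sub by (auto dest: inj_onD)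
  qed
  then show "A \<subseteq> orbit f s" using reach by blast
qed

section \<open>Closed walks along an orbit as directed cycles\<close>

definition orbit_walk :: "('a \<Rightarrow> 'a) \<Rightarrow> 'a \<Rightarrow> nat \<Rightarrow> ('a \<times> 'a) list" where
  "orbit_walk f u n = map (\<lambda>k. ((f ^^ k) u, (f ^^ Suc k) u)) [0..<n]"

text \<open>Splitting off the first arc matches the recursion of \<open>cas\<close> and
  \<open>awalk_verts\<close> on the arc list; the start moves to \<open>f u\<close>, hence the
  inductions over arbitrary \<open>u\<close>.\<close>

lemma orbit_walk_Suc: "orbit_walk f u (Suc n) = (u, f u) # orbit_walk f (f u) n"
proof -
  have "[0..<Suc n] = 0 # map Suc [0..<n]" by (simp add: map_Suc_upt upt_conv_Cons)
  then show ?thesis unfolding orbit_walk_def by (simp add: funpow_swap1)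
qed

lemma cas_orbit_walk: "pre_digraph.cas (with_proj G) u (orbit_walk f u n) ((f ^^ n) u)"
  by (induction n arbitrary: u)
     (simp_all add: pre_digraph.cas.simps orbit_walk_Suc funpow_swap1,
      simp add: orbit_walk_def pre_digraph.cas.simps)

lemma awalk_verts_orbit_walk:
  "pre_digraph.awalk_verts (with_proj G) u (orbit_walk f u n) = map (\<lambda>k. (f ^^ k) u) [0..<Suc n]"
proof (induction n arbitrary: u)
  case 0
  then show ?case by (simp add: orbit_walk_def pre_digraph.awalk_verts.simps)
next
  case (Suc n)
  have "[0..<Suc (Suc n)] = 0 # map Suc [0..<Suc n]" by (simp add: map_Suc_upt upt_conv_Cons)
  then show ?case
    using Suc.IH[of "f u"]
    by (simp add: orbit_walk_Suc pre_digraph.awalk_verts.simps funpow_swap1 del: upt_Suc)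
qed

text \<open>Stopping at the first return time \<open>N\<close> closes the walk and makes each vertex
  the tail of exactly one arc.\<close>

lemma hamilton_cycle_cyclic_on:
  assumes cyc: "cyclic_on f (pverts G)"
    and arcs: "\<And>v. v \<in> pverts G \<Longrightarrow> (v, f v) \<in> parcs G"
  shows "hamilton_cycle (with_proj G) {(v, f v) | v. v \<in> pverts G}"
proof -
  obtain s where s: "s \<in> pverts G" "pverts G = orbit f s"
    using cyc unfolding cyclic_on_def by blast
  then have self: "s \<in> orbit f s" by simp
  define N where "N = funpow_dist1 f s s"
  define p where "p = orbit_walk f s N"
  have orb: "pverts G = (\<lambda>n. (f ^^ n) s) ` {0..<N}"
    unfolding N_def s(2) by (rule orbit_conv_funpow_dist1[OF self])
  have inj: "inj_on (\<lambda>n. (f ^^ n) s) {0..<N}"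
    unfolding N_def by (rule inj_on_funpow_dist1[OF self])
  have ret: "(f ^^ N) s = s"
    unfolding N_def by (rule funpow_dist1_prop[OF self])
  have "N > 0" unfolding N_def by simp
  have set_p: "set p = {(v, f v) | v. v \<in> pverts G}"
    unfolding p_def orbit_walk_def orb by auto
  \<comment> \<open>The start recurs at the end, so a cycle requires distinctness only without the
    first vertex. What remains is the \<open>f\<close>-image of the first \<open>N\<close> orbit
    points, and \<open>f\<close> is injective because it maps a finite set onto itself.\<close>
  have "tl (map (\<lambda>k. (f ^^ k) s) [0..<Suc N]) = map (\<lambda>k. f ((f ^^ k) s)) [0..<N]"
    by (simp add: upt_conv_Cons map_Suc_upt[symmetric] del: upt_Suc)
  moreover have "distinct (map (\<lambda>k. f ((f ^^ k) s)) [0..<N])"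
  proof -
    have "f ` pverts G = pverts G"
    proof
      show "f ` pverts G \<subseteq> pverts G" using cyc by (auto intro: cyclic_on_inI)
      show "pverts G \<subseteq> f ` pverts G"
      proof
        fix v assume "v \<in> pverts G"
        then have "v \<in> orbit f s" using s(2) by simp
        then show "v \<in> f ` pverts G" by cases (use s in auto)
      qed
    qed
    then have "inj_on f (pverts G)"
      using finite_cyclic_on[OF cyc] by (simp add: eq_card_imp_inj_on)
    then have "inj_on (f \<circ> (\<lambda>n. (f ^^ n) s)) {0..<N}"
      using inj orb by (simp add: comp_inj_on)
    then show ?thesis by (simp add: distinct_map comp_def)
  qed
  ultimately have dist: "distinct (tl (pre_digraph.awalk_verts (with_proj G) s p))"
    unfolding p_def awalk_verts_orbit_walk by simp
  have "pre_digraph.awalk (with_proj G) s p s"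
    unfolding pre_digraph.awalk_def set_p
    using cas_orbit_walk[of G s f N] ret s(1) arcs by (auto simp: p_def)
  moreover have "p \<noteq> []" using \<open>N > 0\<close> by (simp add: p_def orbit_walk_def)
  ultimately have "pre_digraph.cycle (with_proj G) p"
    unfolding pre_digraph.cycle_def using dist by blast
  moreover have "tail (with_proj G) ` set p = verts (with_proj G)"
    unfolding set_p by force
  ultimately show ?thesis unfolding hamilton_cycle_def using set_p by blast
qed

section \<open>Skew products\<close>

text \<open>The vertex with first coordinate \<open>i\<close>, third coordinate \<open>k\<close> and coordinate sum \<open>s\<close>
  modulo \<open>m\<close>.\<close>

definition pt :: "nat \<Rightarrow> int \<Rightarrow> int \<Rightarrow> int \<Rightarrow> vertex" where
  "pt m i k s = (nat (i mod int m), nat ((s - i - k) mod int m), nat (k mod int m))"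

lemma nat_mod_Suc: "(nat (a mod int m) + 1) mod m = nat ((a + 1) mod int m)" if "m > 0"
proof -
  have "int ((nat (a mod int m) + 1) mod m) = (a + 1) mod int m"
    using that by (simp add: zmod_int mod_add_right_eq add.commute)
  then show ?thesis by linarith
qed

text \<open>The middle entry encodes \<open>s - i - k\<close>, so adding \<open>i + k\<close>
  recovers \<open>s\<close> modulo \<open>m\<close>.\<close>

lemma pt_eq_iff:
  assumes "m > 0"
  shows "pt m i k s = pt m i' k' s' \<longleftrightarrow>
    i mod int m = i' mod int m \<and> k mod int m = k' mod int m \<and> s mod int m = s' mod int m"
    (is "?L \<longleftrightarrow> ?R")
proof
  assume ?R
  moreover from this have "(s - i - k) mod int m = (s' - i' - k') mod int m"
    by (intro mod_diff_cong) auto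
  ultimately show ?L by (simp add: pt_def)
next
  assume ?L
  then have 1: "i mod int m = i' mod int m" "k mod int m = k' mod int m"
      "(s - i - k) mod int m = (s' - i' - k') mod int m"
    using assms by (auto simp: pt_def nat_eq_iff)
  have "((s - i - k) + (i + k)) mod int m = ((s' - i' - k') + (i' + k')) mod int m"
    by (intro mod_add_cong 1)
  then show ?R using 1 by simp
qed

lemma V_pt: "V m = {pt m i k s | i k s. True}" if "m > 0"
proof
  show "{pt m i k s | i k s. True} \<subseteq> V m"
    using that by (auto simp: V_def pt_def nat_less_iff)
  show "V m \<subseteq> {pt m i k s | i k s. True}"
  proof
    fix v assume "v \<in> V m"
    then obtain i j k where v: "v = (i, j, k)" "i < m" "j < m" "k < m" by (auto simp: V_def)
    then have "v = pt m (int i) (int k) (int i + int j + int k)" by (simp add: pt_def)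
    then show "v \<in> {pt m i k s | i k s. True}" by blast
  qed
qed

lemma bump_pt:
  assumes "m > 0"
  shows "bump_i m (pt m i k s) = pt m (i + 1) k (s + 1)"
    and "bump_j m (pt m i k s) = pt m i k (s + 1)"
    and "bump_k m (pt m i k s) = pt m i (k + 1) (s + 1)"
proof -
  have "(nat ((s - i - k) mod int m) + 1) mod m = nat ((s + 1 - i - k) mod int m)"
    unfolding nat_mod_Suc[OF assms] by (simp add: algebra_simps)
  moreover have "s + 1 - (i + 1) - k = s - i - k" "s + 1 - i - (k + 1) = s - i - k" by simp_all
  ultimately show "bump_i m (pt m i k s) = pt m (i + 1) k (s + 1)"
    and "bump_j m (pt m i k s) = pt m i k (s + 1)"
    and "bump_k m (pt m i k s) = pt m i (k + 1) (s + 1)"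
    using nat_mod_Suc[OF assms] by (simp_all only: pt_def bump_i.simps bump_j.simps bump_k.simps)
qed

lemma S_pt: "S m (pt m i k s) = nat (s mod int m)" if "m > 0"
proof -
  have "int ((nat (i mod int m) + nat ((s - i - k) mod int m) + nat (k mod int m)) mod m) =
      (i mod int m + (s - i - k) mod int m + k mod int m) mod int m"
    using that by (simp add: zmod_int)
  also have "\<dots> = (i + (s - i - k) + k) mod int m"
    by (intro mod_add_cong) (simp_all add: mod_add_eq)
  finally show ?thesis by (simp add: pt_def nat_eq_iff2 flip: of_nat_eq_iff)
qed

lemma third_pt: "third (pt m i k s) = nat (k mod int m)"
  by (simp add: pt_def)

lemma pt_conditions:
  assumes "m > 0"
  shows "S m (pt m i k s) = 0 \<longleftrightarrow> s mod int m = 0"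
    and "S m (pt m i k s) = 1 \<longleftrightarrow> s mod int m = 1"
    and "third (pt m i k s) = 0 \<longleftrightarrow> k mod int m = 0"
proof -
  have "0 \<le> s mod int m" "0 \<le> k mod int m" using assms by simp_all
  then show "S m (pt m i k s) = 0 \<longleftrightarrow> s mod int m = 0"
    and "S m (pt m i k s) = 1 \<longleftrightarrow> s mod int m = 1"
    and "third (pt m i k s) = 0 \<longleftrightarrow> k mod int m = 0"
    unfolding S_pt[OF assms] third_pt by linarith+
qed

text \<open>By Bezout, \<open>u\<close> inverts \<open>b\<close> modulo \<open>m\<close>; the
  residue of \<open>u * c\<close> serves as \<open>n\<close>.\<close>

lemma multiple_mod_eq:
  fixes b c :: int
  assumes "m > 0" "coprime b (int m)"
  obtains n :: nat where "(int n * b) mod int m = c mod int m"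
proof -
  obtain u v where "u * b + v * int m = gcd b (int m)" using bezout_int by blast
  then have uv: "u * b + v * int m = 1" using assms(2) by simp
  have "u * c * b = c * (u * b + v * int m) - c * v * int m" by (simp add: algebra_simps)
  also have "\<dots> = c - c * v * int m" unfolding uv by simp
  finally have "(u * c * b) mod int m = c mod int m"
    using mod_diff_eq[of c "int m" "c * v * int m"] by simp
  moreover have "(int (nat ((u * c) mod int m)) * b) mod int m = (u * c * b) mod int m"
    using assms(1) by (simp add: mod_mult_left_eq)
  ultimately show ?thesis using that by metis
qed

text \<open>Only the arguments of \<open>x\<close> and \<open>y\<close> are reduced modulo
  \<open>m\<close>; the coordinates stay unreduced integers, so increments add up by plain integer
  arithmetic.\<close>

locale skew_product =
  fixes m :: nat and f :: "vertex \<Rightarrow> vertex" and x :: "int \<Rightarrow> int \<Rightarrow> int" and y :: "int \<Rightarrow> int"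
  assumes m_pos: "m > 0"
    and step: "\<And>i k s. f (pt m i k s) =
      pt m (i + x (k mod int m) (s mod int m)) (k + y (s mod int m)) (s + 1)"
begin

abbreviation reach :: "vertex \<Rightarrow> vertex \<Rightarrow> bool" where
  "reach \<equiv> (\<lambda>v w. w = f v)\<^sup>*\<^sup>*"

lemma reach_step: "reach (pt m i k s)
    (pt m (i + x (k mod int m) (s mod int m)) (k + y (s mod int m)) (s + 1))"
  by (rule r_into_rtranclp) (simp add: step)

text \<open>The system is triangular: equal images force equal \<open>s\<close>, then equal
  \<open>k\<close> since \<open>y\<close> sees only \<open>s\<close>, then equal \<open>i\<close>
  since \<open>x\<close> sees only \<open>k\<close> and \<open>s\<close>.\<close>

lemma inj_on_V: "inj_on f (V m)"
proof (rule inj_onI)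
  fix v w assume "v \<in> V m" "w \<in> V m" and eq: "f v = f w"
  then obtain i k s i' k' s' where v: "v = pt m i k s" and w: "w = pt m i' k' s'"
    using V_pt[OF m_pos] by auto
  have cancel: "a mod int m = b mod int m" if "(a + c) mod int m = (b + c) mod int m" for a b c
    using mod_diff_cong[OF that refl[of "c mod int m"]] by simp
  from eq have "(s + 1) mod int m = (s' + 1) mod int m"
    by (simp add: v w step pt_eq_iff[OF m_pos])
  then have s: "s mod int m = s' mod int m" by (rule cancel)
  from eq have "(k + y (s mod int m)) mod int m = (k' + y (s mod int m)) mod int m"
    by (simp add: v w step pt_eq_iff[OF m_pos] s)
  then have k: "k mod int m = k' mod int m" by (rule cancel)
  from eq have "(i + x (k mod int m) (s mod int m)) mod int m =
      (i' + x (k mod int m) (s mod int m)) mod int m"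
    by (simp add: v w step pt_eq_iff[OF m_pos] s k)
  then have "i mod int m = i' mod int m" by (rule cancel)
  then show "v = w" using s k by (simp add: v w pt_eq_iff[OF m_pos])
qed

lemma reach_layer_add: "\<exists>i' k'. reach (pt m i k s) (pt m i' k' (s + int n))"
proof (induction n)
  case 0
  have "reach (pt m i k s) (pt m i k (s + int 0))" by simp
  then show ?case by blast
next
  case (Suc n)
  then obtain i' k' where "reach (pt m i k s) (pt m i' k' (s + int n))" by blast
  from rtranclp_trans[OF this reach_step] show ?case by (auto simp: add_ac)
qed

lemma reach_const:
  assumes "\<And>k t. l \<le> t \<Longrightarrow> t < l + int n \<Longrightarrow> x k t = \<xi> \<and> y t = \<eta>" "0 \<le> l" "l + int n \<le> int m"
  shows "reach (pt m i k l) (pt m (i + int n * \<xi>) (k + int n * \<eta>) (l + int n))"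
  using assms
proof (induction n)
  case 0
  then show ?case by simp
next
  case (Suc n)
  \<comment> \<open>The layer before the last step is still below \<open>m\<close>, so no
    wrap-around occurs.\<close>
  have "(l + int n) mod int m = l + int n" using Suc.prems by simp
  then have xy: "x k' ((l + int n) mod int m) = \<xi>" "y ((l + int n) mod int m) = \<eta>" for k'
    using Suc.prems(1) by auto
  have "reach (pt m i k l) (pt m (i + int n * \<xi>) (k + int n * \<eta>) (l + int n))"
    using Suc by simp
  from rtranclp_trans[OF this reach_step] show ?case
    unfolding xy by (simp add: algebra_simps)
qed

text \<open>Layers 0 and 1 are followed singly; the other \<open>m - 2\<close> layers add constants,
  and \<open>m - 2\<close> is -2 modulo \<open>m\<close>.\<close>

lemma return_map:
  assumes "m \<ge> 2" and const: "\<And>k t. 2 \<le> t \<Longrightarrow> t < int m \<Longrightarrow> x k t = \<xi> \<and> y t = \<eta>"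
  shows "reach (pt m i k 0)
    (pt m (i + x (k mod int m) 0 + x ((k + y 0) mod int m) 1 - 2 * \<xi>) (k + y 0 + y 1 - 2 * \<eta>) 0)"
proof -
  define i2 k2 where "i2 = i + x (k mod int m) 0 + x ((k + y 0) mod int m) 1"
    and "k2 = k + y 0 + y 1"
  have "reach (pt m i k 0) (pt m (i + x (k mod int m) 0) (k + y 0) 1)"
    using reach_step[of i k 0] by simp
  also have "reach \<dots> (pt m i2 k2 2)"
    using reach_step[of "i + x (k mod int m) 0" "k + y 0" 1] \<open>m \<ge> 2\<close> by (simp add: i2_def k2_def)
  also have "reach \<dots> (pt m (i2 + int (m - 2) * \<xi>) (k2 + int (m - 2) * \<eta>) (2 + int (m - 2)))"
    using \<open>m \<ge> 2\<close> by (intro reach_const const) auto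
  also have "\<dots> = pt m (i2 - 2 * \<xi>) (k2 - 2 * \<eta>) 0"
  proof -
    have "i2 + int (m - 2) * \<xi> = i2 - 2 * \<xi> + int m * \<xi>"
      "k2 + int (m - 2) * \<eta> = k2 - 2 * \<eta> + int m * \<eta>"
      using \<open>m \<ge> 2\<close> by (simp_all add: of_nat_diff algebra_simps)
    then show ?thesis using \<open>m \<ge> 2\<close> by (simp only:) (simp add: pt_eq_iff)
  qed
  finally show ?thesis by (simp add: i2_def k2_def)
qed

text \<open>Every vertex is driven to \<open>pt m 0 c 0\<close> in three stages: up to layer 0, by
  returns to column \<open>c\<close>, then by full rounds of the columns to first coordinate
  0.\<close>

lemma cyclic_on_V:
  assumes ret: "\<And>i k. reach (pt m i k 0)
      (pt m (i + (if k mod int m = c mod int m then \<alpha> else \<beta>)) (k + b) 0)"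
    and b: "coprime b (int m)" and \<alpha>\<beta>: "coprime (\<alpha> - \<beta>) (int m)"
  shows "cyclic_on f (V m)"
proof (rule cyclic_onI_reaches)
  show "finite (V m)" by (simp add: V_def)
  show "f ` V m \<subseteq> V m" unfolding V_pt[OF m_pos] by (auto simp: step) blast
  show "pt m 0 c 0 \<in> V m" using V_pt[OF m_pos] by blast
  have many: "\<exists>i'. reach (pt m i k 0) (pt m i' (k + int n * b) 0)" for i k n
  proof (induction n)
    case 0
    then show ?case by (auto intro!: exI[of _ i])
  next
    case (Suc n)
    then obtain i' where "reach (pt m i k 0) (pt m i' (k + int n * b) 0)" by blast
    from rtranclp_trans[OF this ret] show ?case by (auto simp: algebra_simps)
  qed
  \<comment> \<open>The first of \<open>m\<close> returns leaves column \<open>c\<close> and adds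
    \<alpha>; the other \<open>m - 1\<close> add \<beta> each, which is -\<beta> in total modulo
    \<open>m\<close>.\<close>
  have round: "reach (pt m i c 0) (pt m (i + (\<alpha> - \<beta>)) c 0)" for i
  proof -
    have "reach (pt m i c 0) (pt m (i + \<alpha> + int n * \<beta>) (c + b + int n * b) 0)"
      if "n < m" for n
      using that
    proof (induction n)
      case 0
      then show ?case using ret[of i c] by simp
    next
      case (Suc n)
      \<comment> \<open>As \<open>b\<close> is a unit, column \<open>c\<close> recurs only after a
        multiple of \<open>m\<close> returns.\<close>
      have "(c + b + int n * b) mod int m \<noteq> c mod int m"
      proof
        assume "(c + b + int n * b) mod int m = c mod int m"
        then have "int m dvd (int n + 1) * b"
          by (simp add: mod_eq_dvd_iff algebra_simps)
        then have "int m dvd int (Suc n)"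
          using b by (simp add: coprime_dvd_mult_left_iff coprime_commute add.commute)
        then have "m dvd Suc n" by (simp only: int_dvd_int_iff)
        then show False using Suc.prems by (auto dest: dvd_imp_le)
      qed
      then have "reach (pt m (i + \<alpha> + int n * \<beta>) (c + b + int n * b) 0)
          (pt m (i + \<alpha> + int n * \<beta> + \<beta>) (c + b + int n * b + b) 0)"
        using ret[of "i + \<alpha> + int n * \<beta>" "c + b + int n * b"] by simp
      from rtranclp_trans[OF Suc.IH this] Suc.prems show ?case by (simp add: algebra_simps)
    qed
    from this[of "m - 1"] have "reach (pt m i c 0)
        (pt m (i + \<alpha> + int (m - 1) * \<beta>) (c + b + int (m - 1) * b) 0)"
      using m_pos by simp
    moreover have "i + \<alpha> + int (m - 1) * \<beta> = i + (\<alpha> - \<beta>) + int m * \<beta>"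
      "c + b + int (m - 1) * b = c + int m * b"
      using m_pos by (simp_all add: of_nat_diff algebra_simps)
    then have "pt m (i + \<alpha> + int (m - 1) * \<beta>) (c + b + int (m - 1) * b) 0 =
        pt m (i + (\<alpha> - \<beta>)) c 0"
      using m_pos by (simp only:) (simp add: pt_eq_iff)
    ultimately show ?thesis by simp
  qed
  have rounds: "reach (pt m i c 0) (pt m (i + int n * (\<alpha> - \<beta>)) c 0)" for i n
  proof (induction n)
    case 0
    then show ?case by simp
  next
    case (Suc n)
    from rtranclp_trans[OF this round] show ?case by (simp add: algebra_simps)
  qed
  fix v assume "v \<in> V m"
  then obtain i k s where v: "v = pt m i k s" using V_pt[OF m_pos] by auto
  \<comment> \<open>The step count is the residue of \<open>- s\<close>, which completes the layer
    to 0.\<close>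
  have "\<exists>i' k'. reach v (pt m i' k' (s + int (nat ((- s) mod int m))))"
    unfolding v by (rule reach_layer_add)
  then obtain i1 k1 where "reach v (pt m i1 k1 (s + int (nat ((- s) mod int m))))" by blast
  also have "\<dots> = pt m i1 k1 0"
    using m_pos by (simp add: pt_eq_iff mod_simps)
  finally have r1: "reach v (pt m i1 k1 0)" .
  obtain n where "(int n * b) mod int m = (c - k1) mod int m"
    using multiple_mod_eq[OF m_pos b] by blast
  then have n: "(k1 + int n * b) mod int m = c mod int m"
    using mod_add_cong[of k1 "int m" k1 "int n * b" "c - k1"] by simp
  obtain i2 where "reach (pt m i1 k1 0) (pt m i2 (k1 + int n * b) 0)" using many by blast
  also have "\<dots> = pt m i2 c 0" using n by (simp add: pt_eq_iff[OF m_pos])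
  finally have r2: "reach (pt m i1 k1 0) (pt m i2 c 0)" .
  obtain n' where "(int n' * (\<alpha> - \<beta>)) mod int m = (- i2) mod int m"
    using multiple_mod_eq[OF m_pos \<alpha>\<beta>] by blast
  then have n': "(i2 + int n' * (\<alpha> - \<beta>)) mod int m = 0 mod int m"
    using mod_add_cong[of i2 "int m" i2 "int n' * (\<alpha> - \<beta>)" "- i2"] by simp
  have "reach (pt m i2 c 0) (pt m (i2 + int n' * (\<alpha> - \<beta>)) c 0)" by (rule rounds)
  also have "\<dots> = pt m 0 c 0" using n' by (simp add: pt_eq_iff[OF m_pos])
  finally have "reach v (pt m 0 c 0)" using r1 r2 by (meson rtranclp_trans)
  then show "\<exists>n. (f ^^ n) v = pt m 0 c 0"
  proof induction
    case base
    then show ?case by (intro exI[of _ 0]) simp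
  next
    case (step w z)
    then obtain n where "(f ^^ n) v = w" by blast
    with step show ?case by (intro exI[of _ "Suc n"]) simp
  qed
qed (rule inj_on_V)

end

section \<open>The three colours\<close>

text \<open>Layer 0 adds 1 to \<open>i\<close> exactly in column 0, layer 1 adds 1 to
  \<open>k\<close>, and the remaining layers add -2 to \<open>i\<close> modulo
  \<open>m\<close>.\<close>

lemma cyclic_on_f0:
  assumes "m \<ge> 2"
  shows "cyclic_on (f0 m) (V m)"
proof -
  interpret skew_product m "f0 m"
    "\<lambda>k s. if s = 0 then (if k = 0 then 1 else 0) else if s = 1 then 0 else 1"
    "\<lambda>s. if s = 1 then 1 else 0"
    using assms by unfold_locales
      (simp_all add: f0_def pt_conditions bump_pt del: One_nat_def)
  show ?thesis
  proof (rule cyclic_on_V[where c = 0 and \<alpha> = "-1" and \<beta> = "-2" and b = 1])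
    fix i k
    show "reach (pt m i k 0)
      (pt m (i + (if k mod int m = 0 mod int m then - 1 else - 2)) (k + 1) 0)"
      using return_map[of 1 0 i k] assms by (auto split: if_splits)
  qed auto
qed

lemma cyclic_on_f1:
  assumes "m \<ge> 2"
  shows "cyclic_on (f1 m) (V m)"
proof -
  interpret skew_product m "f1 m"
    "\<lambda>k s. if s = 1 \<and> k = 0 then 1 else 0" "\<lambda>s. if s = 0 then 1 else 0"
    using assms by unfold_locales
      (simp_all add: f1_def pt_conditions bump_pt del: One_nat_def)
  show ?thesis
  proof (rule cyclic_on_V[where c = "-1" and \<alpha> = 1 and \<beta> = 0 and b = 1])
    fix i k
    \<comment> \<open>Layer 0 has already raised \<open>k\<close> when layer 1 tests it for 0, so
      the exceptional column is -1.\<close>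
    have "(k + 1) mod int m = 0 \<longleftrightarrow> k mod int m = (- 1) mod int m"
      by (simp add: mod_eq_dvd_iff mod_eq_0_iff_dvd)
    then show "reach (pt m i k 0)
      (pt m (i + (if k mod int m = (- 1) mod int m then 1 else 0)) (k + 1) 0)"
      using return_map[of 0 0 i k] assms by (auto split: if_splits)
  qed auto
qed

text \<open>Layers 0 and 1 keep \<open>k\<close>, so both make the same test and together add 0 or 2
  to \<open>i\<close>; the remaining layers add -2 to \<open>k\<close> modulo
  \<open>m\<close>.\<close>

lemma cyclic_on_f2:
  assumes "m \<ge> 2" "odd m"
  shows "cyclic_on (f2 m) (V m)"
proof -
  interpret skew_product m "f2 m"
    "\<lambda>k s. if s \<in> {0, 1} \<and> k \<noteq> 0 then 1 else 0" "\<lambda>s. if s \<in> {0, 1} then 0 else 1"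
    using assms by unfold_locales
      (simp_all add: f2_def pt_conditions bump_pt del: One_nat_def)
  show ?thesis
  proof (rule cyclic_on_V[where c = 0 and \<alpha> = 0 and \<beta> = 2 and b = "-2"])
    fix i k
    show "reach (pt m i k 0)
      (pt m (i + (if k mod int m = 0 mod int m then 0 else 2)) (k + - 2) 0)"
      using return_map[of 0 1 i k] assms by (auto simp: add.commute split: if_splits)
  \<comment> \<open>Both \<open>b\<close> and \<alpha> - \<beta> equal -2, a unit modulo
    \<open>m\<close> because \<open>m\<close> is odd.\<close>
  qed (use assms in auto)
qed

section \<open>Partition of the arcs into colour classes\<close>

lemma colors_cover: "{f0 m v, f1 m v, f2 m v} = {bump_i m v, bump_j m v, bump_k m v}"
  unfolding f0_def f1_def f2_def
  by (cases "S m v = 0"; cases "S m v = 1"; cases "third v = 0") auto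

lemma colors_distinct:
  assumes "m \<ge> 2" "v \<in> V m"
  shows "f0 m v \<noteq> f1 m v" "f0 m v \<noteq> f2 m v" "f1 m v \<noteq> f2 m v"
proof -
  have "(a + 1) mod m \<noteq> a" if "a < m" for a
    using that assms(1) by (cases "a + 1 < m") (auto simp: not_less le_Suc_eq)
  then have "bump_i m v \<noteq> bump_j m v" "bump_i m v \<noteq> bump_k m v" "bump_j m v \<noteq> bump_k m v"
    using assms(2) by (auto simp: V_def)
  then show "f0 m v \<noteq> f1 m v" "f0 m v \<noteq> f2 m v" "f1 m v \<noteq> f2 m v"
    unfolding f0_def f1_def f2_def by auto
qed

theorem theorem3p5:
  fixes m :: nat
  assumes "m \<ge> 3" and "odd m"
  shows "card (V m) = m ^ 3 \<and>
    (\<forall>c \<in> {0, 1, 2}. cyclic_on (coloring m c) (V m)) \<and>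
    hamilton_decomposition (with_proj (D3 m)) {0, 1, 2} (color_class m)"
proof (intro conjI)
  have m: "m \<ge> 2" using assms by simp
  show "card (V m) = m ^ 3" by (simp add: V_def power3_eq_cube)
  show cyc: "\<forall>c \<in> {0, 1, 2}. cyclic_on (coloring m c) (V m)"
    using cyclic_on_f0[OF m] cyclic_on_f1[OF m] cyclic_on_f2[OF m assms(2)]
    by (simp add: coloring_def)
  have verts: "pverts (D3 m) = V m" by (simp add: D3_def)
  have arcs: "(\<Union>c\<in>{0, 1, 2}. color_class m c) = parcs (D3 m)"
  proof -
    have "parcs (D3 m) = {(v, w). v \<in> V m \<and> w \<in> {f0 m v, f1 m v, f2 m v}}"
      by (simp add: D3_def colors_cover)
    then show ?thesis by (auto simp: color_class_def coloring_def)
  qed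
  have "hamilton_cycle (with_proj (D3 m)) (color_class m c)" if c: "c \<in> {0, 1, 2}" for c
  proof -
    have "cyclic_on (coloring m c) (pverts (D3 m))" using cyc c verts by auto
    moreover have "(v, coloring m c v) \<in> parcs (D3 m)" if "v \<in> pverts (D3 m)" for v
      using that c unfolding arcs[symmetric] verts color_class_def by blast
    ultimately show ?thesis
      using hamilton_cycle_cyclic_on[of "coloring m c" "D3 m"] by (simp add: verts color_class_def)
  qed
  \<comment> \<open>An arc in two classes would have a tail at which two colours agree.\<close>
  moreover have "disjoint_family_on (color_class m) {0, 1, 2}"
    using colors_distinct[OF m]
    by (fastforce simp: disjoint_family_on_def color_class_def coloring_def)
  ultimately show "hamilton_decomposition (with_proj (D3 m)) {0, 1, 2} (color_class m)"
    using arcs by (simp add: hamilton_decomposition_def)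
qed

end
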